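(* Let $R$ be a commutative noetherian ring, let $\mathcal{S}$ be a subcategory of $R$-Mod which is closed under taking submodules and let $\mathfrak{a}$ be an ideal of $R$. Then the following statements hold. (i) If $\mathcal{S}$ is closed under taking arbitrary direct sums, then so is $\mathcal{S}_{\mathfrak{a}}$. (ii) If $\mathcal{S}$ is a torsion subcategory, then $\mathcal{S}$ satisfies the $C_{\mathfrak{a}}$ condition.
   Context: $R$-Mod is the category of $R$-modules; all subcategories are full (identified with their classes of objects). A subcategory is Serre if it is closed under taking submodules, quotients and extensions. A torsion subcategory is a Serre subcategory of $R$-Mod closed under taking arbitrary direct sums of modules. For an ideal $\mathfrak{a}$ and an $R$-module $M$, $\Gamma_{\mathfrak{a}}(M)=\{m\in M : \mathfrak{a}^k m=0 \text{ for some } k\ge 1\}$ and $(0:_M\mathfrak{a})=\{m\in M:\mathfrak{a}m=0\}$. A class $\mathcal{S}$ of $R$-modules satisfies the $C_{\mathfrak{a}}$ condition on an $R$-module $M$ if: $\Gamma_{\mathfrak{a}}(M)=M$ and $(0:_M\mathfrak{a})\in\mathcal{S}$ imply $M\in\mathcal{S}$; it satisfies the $C_{\mathfrak{a}}$ condition on a class $\mathcal{D}$ if it does so on every $M\in\mathcal{D}$. $\mathcal{S}_{\mathfrak{a}}$ denotes the largest subclass of $R$-Mod such that $\mathcal{S}$ satisfies the $C_{\mathfrak{a}}$ condition on $\mathcal{S}_{\mathfrak{a}}$, i.e. the class of all $R$-modules $M$ such that $\mathcal{S}$ satisfies the $C_{\mathfrak{a}}$ condition on $M$. $\mathcal{S}$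 satisfies the $C_{\mathfrak{a}}$ condition if $\mathcal{S}_{\mathfrak{a}}=R$-Mod. *)

theory Defs
  imports "HOL-Algebra.Module" "HOL-Algebra.Ideal_Product" "HOL-Algebra.Ring_Divisibility"
begin

text \<open>
  A type variable 'm plays the role of the universe of \<open>R\<close>-modules: \<open>RMod R\<close> consists of the
  \<open>R\<close>-modules whose carrier is a set of elements of 'm, and 'm is arbitrary. A full subcategory is
  a subset of \<open>RMod R\<close>. The fields \<open>mult\<close> and \<open>one\<close> of a module record carry no
  information about the module, and the operations are arbitrary outside the carrier; all closure
  conditions below are therefore stated up to isomorphism, through homomorphisms.
\<close>

definition RMod :: "('r, 'x) ring_scheme \<Rightarrow> ('r, 'm) module set" where
  "RMod R = {M. Module.module R M}"

definition mod_hom ::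
    "('r, 'x) ring_scheme \<Rightarrow> ('r, 'm, 'y) module_scheme \<Rightarrow> ('r, 'n, 'z) module_scheme \<Rightarrow> ('m \<Rightarrow> 'n) set"
  where
  "mod_hom R M N = {f \<in> carrier M \<rightarrow> carrier N.
     (\<forall>x\<in>carrier M. \<forall>y\<in>carrier M. f (x \<oplus>\<^bsub>M\<^esub> y) = f x \<oplus>\<^bsub>N\<^esub> f y) \<and>
     (\<forall>r\<in>carrier R. \<forall>x\<in>carrier M. f (r \<odot>\<^bsub>M\<^esub> x) = r \<odot>\<^bsub>N\<^esub> f x)}"

definition mod_iso ::
    "('r, 'x) ring_scheme \<Rightarrow> ('r, 'm, 'y) module_scheme \<Rightarrow> ('r, 'n, 'z) module_scheme \<Rightarrow> ('m \<Rightarrow> 'n) set"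
  where
  "mod_iso R M N = {f \<in> mod_hom R M N. bij_betw f (carrier M) (carrier N)}"

definition closed_under_submodules :: "('r, 'x) ring_scheme \<Rightarrow> ('r, 'm) module set \<Rightarrow> bool" where
  "closed_under_submodules R \<S> \<longleftrightarrow>
     (\<forall>M\<in>\<S>. \<forall>N\<in>RMod R. (\<exists>f\<in>mod_hom R N M. inj_on f (carrier N)) \<longrightarrow> N \<in> \<S>)"

definition closed_under_quotients :: "('r, 'x) ring_scheme \<Rightarrow> ('r, 'm) module set \<Rightarrow> bool" where
  "closed_under_quotients R \<S> \<longleftrightarrow>
     (\<forall>M\<in>\<S>. \<forall>N\<in>RMod R. (\<exists>f\<in>mod_hom R M N. f ` carrier M = carrier N) \<longrightarrow> N \<in> \<S>)"

definition short_exact ::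
    "('r, 'x) ring_scheme \<Rightarrow> ('r, 'l) module \<Rightarrow> ('l \<Rightarrow> 'm) \<Rightarrow> ('r, 'm) module \<Rightarrow> ('m \<Rightarrow> 'n) \<Rightarrow> ('r, 'n) module \<Rightarrow> bool"
  where
  "short_exact R L f M g N \<longleftrightarrow>
     f \<in> mod_hom R L M \<and> g \<in> mod_hom R M N \<and>
     inj_on f (carrier L) \<and>
     f ` carrier L = {x \<in> carrier M. g x = \<zero>\<^bsub>N\<^esub>} \<and>
     g ` carrier M = carrier N"

definition closed_under_extensions :: "('r, 'x) ring_scheme \<Rightarrow> ('r, 'm) module set \<Rightarrow> bool" where
  "closed_under_extensions R \<S> \<longleftrightarrow>
     (\<forall>L\<in>\<S>. \<forall>N\<in>\<S>. \<forall>M\<in>RMod R. (\<exists>f g. short_exact R L f M g N) \<longrightarrow> M \<in> \<S>)"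

text \<open>The external direct sum: families of finite support, with componentwise operations.\<close>

definition direct_sum :: "'i set \<Rightarrow> ('i \<Rightarrow> ('r, 'm) module) \<Rightarrow> ('r, 'i \<Rightarrow> 'm) module" where
  "direct_sum I N =
     \<lparr>carrier = {x \<in> \<Pi>\<^sub>E i\<in>I. carrier (N i). finite {i \<in> I. x i \<noteq> \<zero>\<^bsub>N i\<^esub>}},
      monoid.mult = undefined,
      one = undefined,
      zero = (\<lambda>i\<in>I. \<zero>\<^bsub>N i\<^esub>),
      add = (\<lambda>x y. \<lambda>i\<in>I. x i \<oplus>\<^bsub>N i\<^esub> y i),
      smult = (\<lambda>r x. \<lambda>i\<in>I. r \<odot>\<^bsub>N i\<^esub> x i)\<rparr>"

text \<open>
  All direct sums that exist in the universe 'm up to isomorphism. Index sets in 'm suffice, since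
  a direct sum that fits into 'm has at most as many nonzero summands as 'm has elements; see the
  lemma \<open>closed_under_direct_sums_any_index\<close> below, in which the index type is arbitrary.
\<close>

definition closed_under_direct_sums :: "('r, 'x) ring_scheme \<Rightarrow> ('r, 'm) module set \<Rightarrow> bool" where
  "closed_under_direct_sums R \<S> \<longleftrightarrow>
     (\<forall>(I :: 'm set) N. \<forall>M\<in>RMod R.
        (\<forall>i\<in>I. N i \<in> \<S>) \<and> (\<exists>f. f \<in> mod_iso R (direct_sum I N) M) \<longrightarrow> M \<in> \<S>)"

definition Serre :: "('r, 'x) ring_scheme \<Rightarrow> ('r, 'm) module set \<Rightarrow> bool" where
  "Serre R \<S> \<longleftrightarrow> \<S> \<subseteq> RMod R \<and> closed_under_submodules R \<S> \<and>
     closed_under_quotients R \<S> \<and> closed_under_extensions R \<S>"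

definition torsion_subcategory :: "('r, 'x) ring_scheme \<Rightarrow> ('r, 'm) module set \<Rightarrow> bool" where
  "torsion_subcategory R \<S> \<longleftrightarrow> Serre R \<S> \<and> closed_under_direct_sums R \<S>"

text \<open>Powers of an ideal are taken in the multiplicative monoid \<open>ideals_set R\<close> of all ideals.\<close>

definition Gamma :: "('r, 'x) ring_scheme \<Rightarrow> 'r set \<Rightarrow> ('r, 'm) module \<Rightarrow> 'm set" where
  "Gamma R \<aa> M = {m \<in> carrier M.
     \<exists>k::nat. k \<ge> 1 \<and> (\<forall>r \<in> \<aa> [^]\<^bsub>ideals_set R\<^esub> k. r \<odot>\<^bsub>M\<^esub> m = \<zero>\<^bsub>M\<^esub>)}"

definition annihilated :: "'r set \<Rightarrow> ('r, 'm) module \<Rightarrow> ('r, 'm) module" where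
  "annihilated \<aa> M = M\<lparr>carrier := {m \<in> carrier M. \<forall>r\<in>\<aa>. r \<odot>\<^bsub>M\<^esub> m = \<zero>\<^bsub>M\<^esub>}\<rparr>"

definition C_condition_at ::
    "('r, 'x) ring_scheme \<Rightarrow> 'r set \<Rightarrow> ('r, 'm) module set \<Rightarrow> ('r, 'm) module \<Rightarrow> bool" where
  "C_condition_at R \<aa> \<S> M \<longleftrightarrow> (Gamma R \<aa> M = carrier M \<and> annihilated \<aa> M \<in> \<S> \<longrightarrow> M \<in> \<S>)"

definition C_class ::
    "('r, 'x) ring_scheme \<Rightarrow> 'r set \<Rightarrow> ('r, 'm) module set \<Rightarrow> ('r, 'm) module set" where
  "C_class R \<aa> \<S> = {M \<in> RMod R. C_condition_at R \<aa> \<S> M}"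

definition C_condition :: "('r, 'x) ring_scheme \<Rightarrow> 'r set \<Rightarrow> ('r, 'm) module set \<Rightarrow> bool" where
  "C_condition R \<aa> \<S> \<longleftrightarrow> C_class R \<aa> \<S> = RMod R"


lemma direct_sum_simps [simp]:
  "carrier (direct_sum I N) = {x \<in> \<Pi>\<^sub>E i\<in>I. carrier (N i). finite {i \<in> I. x i \<noteq> \<zero>\<^bsub>N i\<^esub>}}"
  "\<zero>\<^bsub>direct_sum I N\<^esub> = (\<lambda>i\<in>I. \<zero>\<^bsub>N i\<^esub>)"
  "x \<oplus>\<^bsub>direct_sum I N\<^esub> y = (\<lambda>i\<in>I. x i \<oplus>\<^bsub>N i\<^esub> y i)"
  "r \<odot>\<^bsub>direct_sum I N\<^esub> x = (\<lambda>i\<in>I. r \<odot>\<^bsub>N i\<^esub> x i)"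
  by (simp_all add: direct_sum_def)

lemma module_direct_sum:
  assumes R: "cring R" and N: "\<And>i. i \<in> I \<Longrightarrow> Module.module R (N i)"
  shows "Module.module R (direct_sum I N)"
proof -
  let ?D = "direct_sum I N"
  have g: "abelian_group (N i)" if "i \<in> I" for i
    using N[OF that] by (simp add: Module.module_def)
  note m = abelian_groupE[OF g]
  have am: "abelian_monoid (N i)" if "i \<in> I" for i
    using g[OF that] by (simp add: abelian_group_def)
  show ?thesis
  proof (rule moduleI)
    show "abelian_group ?D"
    proof (rule abelian_groupI)
      fix x y assume x: "x \<in> carrier ?D" and y: "y \<in> carrier ?D"
      have "finite ({i \<in> I. x i \<noteq> \<zero>\<^bsub>N i\<^esub>} \<union> {i \<in> I. y i \<noteq> \<zero>\<^bsub>N i\<^esub>})"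
        using x y by simp
      moreover have "{i \<in> I. x i \<oplus>\<^bsub>N i\<^esub> y i \<noteq> \<zero>\<^bsub>N i\<^esub>} \<subseteq> {i \<in> I. x i \<noteq> \<zero>\<^bsub>N i\<^esub>} \<union> {i \<in> I. y i \<noteq> \<zero>\<^bsub>N i\<^esub>}"
        using abelian_monoid.r_zero[OF am] abelian_monoid.zero_closed[OF am] by fastforce
      ultimately have "finite {i \<in> I. x i \<oplus>\<^bsub>N i\<^esub> y i \<noteq> \<zero>\<^bsub>N i\<^esub>}"
        by (rule rev_finite_subset)
      then show "x \<oplus>\<^bsub>?D\<^esub> y \<in> carrier ?D"
        using x y m(1) by (auto simp: PiE_iff cong: conj_cong)
    next
      show "\<zero>\<^bsub>?D\<^esub> \<in> carrier ?D" using m(2) by (auto cong: conj_cong)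
    next
      fix x y z assume "x \<in> carrier ?D" "y \<in> carrier ?D" "z \<in> carrier ?D"
      then show "(x \<oplus>\<^bsub>?D\<^esub> y) \<oplus>\<^bsub>?D\<^esub> z = x \<oplus>\<^bsub>?D\<^esub> (y \<oplus>\<^bsub>?D\<^esub> z)"
        by (auto simp: PiE_iff m(3) intro!: restrict_ext)
    next
      fix x y assume "x \<in> carrier ?D" "y \<in> carrier ?D"
      then show "x \<oplus>\<^bsub>?D\<^esub> y = y \<oplus>\<^bsub>?D\<^esub> x"
        by (auto simp: PiE_iff m(4) intro!: restrict_ext)
    next
      fix x assume x: "x \<in> carrier ?D"
      then show "\<zero>\<^bsub>?D\<^esub> \<oplus>\<^bsub>?D\<^esub> x = x"
        by (intro extensionalityI[of _ I]) (auto simp: PiE_iff m(5))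
      have neg0: "\<ominus>\<^bsub>N i\<^esub> \<zero>\<^bsub>N i\<^esub> = \<zero>\<^bsub>N i\<^esub>" if "i \<in> I" for i
        using abelian_group.l_neg[OF g[OF that] m(2)[OF that]] abelian_group.a_inv_closed[OF g[OF that] m(2)[OF that]]
          abelian_monoid.r_zero[OF am[OF that]] by metis
      define y where "y = (\<lambda>i\<in>I. \<ominus>\<^bsub>N i\<^esub> x i)"
      have "{i \<in> I. y i \<noteq> \<zero>\<^bsub>N i\<^esub>} \<subseteq> {i \<in> I. x i \<noteq> \<zero>\<^bsub>N i\<^esub>}"
        using g neg0 by (auto simp: y_def)
      then have "finite {i \<in> I. y i \<noteq> \<zero>\<^bsub>N i\<^esub>}"
        using x finite_subset by auto
      then have "y \<in> carrier ?D"
        using x g by (auto simp: PiE_iff y_def abelian_group.a_inv_closed)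
      moreover have "y \<oplus>\<^bsub>?D\<^esub> x = \<zero>\<^bsub>?D\<^esub>"
        using x g by (auto simp: PiE_iff y_def abelian_group.l_neg intro!: restrict_ext)
      ultimately show "\<exists>y\<in>carrier ?D. y \<oplus>\<^bsub>?D\<^esub> x = \<zero>\<^bsub>?D\<^esub>" by blast
    qed
  next
    fix r x assume r: "r \<in> carrier R" and x: "x \<in> carrier ?D"
    have "{i \<in> I. r \<odot>\<^bsub>N i\<^esub> x i \<noteq> \<zero>\<^bsub>N i\<^esub>} \<subseteq> {i \<in> I. x i \<noteq> \<zero>\<^bsub>N i\<^esub>}"
      using r by (auto simp: Module.module.smult_r_null[OF N])
    then have "finite {i \<in> I. r \<odot>\<^bsub>N i\<^esub> x i \<noteq> \<zero>\<^bsub>N i\<^esub>}"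
      using x finite_subset by auto
    then show "r \<odot>\<^bsub>?D\<^esub> x \<in> carrier ?D"
      using r x by (auto simp: PiE_iff Module.module.smult_closed[OF N] cong: conj_cong)
  next
    fix x assume "x \<in> carrier ?D"
    then show "\<one>\<^bsub>R\<^esub> \<odot>\<^bsub>?D\<^esub> x = x"
      by (intro extensionalityI[of _ I]) (auto simp: PiE_iff Module.module.smult_one[OF N])
  qed (use R in \<open>auto simp: PiE_iff Module.module.smult_l_distr[OF N] Module.module.smult_r_distr[OF N]
         Module.module.smult_assoc1[OF N] intro!: restrict_ext\<close>)
qed

lemma module_annihilated:
  assumes M: "Module.module R M" and a: "ideal \<aa> R"
  shows "Module.module R (annihilated \<aa> M)"
proof -
  interpret M: Module.module R M by (rule M)
  interpret a: ideal \<aa> R by (rule a)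
  have "submodule {m \<in> carrier M. \<forall>r\<in>\<aa>. r \<odot>\<^bsub>M\<^esub> m = \<zero>\<^bsub>M\<^esub>} R M"
  proof (rule M.submoduleI)
    fix s x
    assume s: "s \<in> carrier R" and x: "x \<in> {m \<in> carrier M. \<forall>r\<in>\<aa>. r \<odot>\<^bsub>M\<^esub> m = \<zero>\<^bsub>M\<^esub>}"
    have "r \<odot>\<^bsub>M\<^esub> (s \<odot>\<^bsub>M\<^esub> x) = \<zero>\<^bsub>M\<^esub>" if r: "r \<in> \<aa>" for r
      using x s r a.I_r_closed[OF r s] a.Icarr[OF r] by (simp flip: M.smult_assoc1)
    then show "s \<odot>\<^bsub>M\<^esub> x \<in> {m \<in> carrier M. \<forall>r\<in>\<aa>. r \<odot>\<^bsub>M\<^esub> m = \<zero>\<^bsub>M\<^esub>}"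
      using s x by simp
  qed (auto simp: a.Icarr M.smult_r_minus M.smult_r_distr)
  then show ?thesis
    unfolding annihilated_def by (rule submodule.submodule_is_module[OF _ M])
qed

lemma closed_under_direct_sums_any_index:
  fixes I :: "'i set" and N :: "'i \<Rightarrow> ('r, 'm) module" and M :: "('r, 'm) module"
  assumes S: "\<S> \<subseteq> RMod R" "closed_under_direct_sums R \<S>"
    and N: "\<And>i. i \<in> I \<Longrightarrow> N i \<in> \<S>"
    and M: "M \<in> RMod R" and f: "f \<in> mod_iso R (direct_sum I N) M"
  shows "M \<in> \<S>"
proof -
  have mN: "Module.module R (N i)" if "i \<in> I" for i
    using N[OF that] S(1) by (auto simp: RMod_def)
  have zN: "\<zero>\<^bsub>N i\<^esub> \<in> carrier (N i)" if "i \<in> I" for i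
    using mN[OF that] by (simp add: Module.module_def abelian_group_def abelian_monoid.zero_closed)
  define J where "J = {i \<in> I. carrier (N i) \<noteq> {\<zero>\<^bsub>N i\<^esub>}}"
  have JI: "J \<subseteq> I" by (auto simp: J_def)
  have outside: "x i = \<zero>\<^bsub>N i\<^esub>" if "x i \<in> carrier (N i)" "i \<in> I" "i \<notin> J" for x i
    using that by (auto simp: J_def)
  have "\<forall>i\<in>J. \<exists>n. n \<in> carrier (N i) \<and> n \<noteq> \<zero>\<^bsub>N i\<^esub>"
    using zN by (auto simp: J_def)
  then obtain n where n: "\<And>i. i \<in> J \<Longrightarrow> n i \<in> carrier (N i) \<and> n i \<noteq> \<zero>\<^bsub>N i\<^esub>"
    by metis
  define e where "e i = (\<lambda>j\<in>I. if j = i then n i else \<zero>\<^bsub>N j\<^esub>)" for i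
  have e: "e i \<in> carrier (direct_sum I N)" if "i \<in> J" for i
  proof -
    have "{j \<in> I. e i j \<noteq> \<zero>\<^bsub>N j\<^esub>} \<subseteq> {i}" by (auto simp: e_def)
    then have "finite {j \<in> I. e i j \<noteq> \<zero>\<^bsub>N j\<^esub>}" using finite_subset by blast
    then show ?thesis using n[OF that] zN by (auto simp: e_def)
  qed
  have "inj_on e J"
  proof (rule inj_onI)
    fix i j assume i: "i \<in> J" and j: "j \<in> J" and "e i = e j"
    then have "e i i = e j i" by simp
    with n[OF i] JI i show "i = j" by (auto simp: e_def split: if_splits)
  qed
  moreover have bf: "bij_betw f (carrier (direct_sum I N)) (carrier M)"
    and hf: "f \<in> mod_hom R (direct_sum I N) M"
    using f by (auto simp: mod_iso_def)
  ultimately have c: "inj_on (f \<circ> e) J"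
    using e by (intro comp_inj_on) (auto simp: bij_betw_def intro: inj_on_subset simp del: direct_sum_simps)
  define c where "c = f \<circ> e"
  define d where "d = the_inv_into J c"
  have dc: "d (c i) = i" if "i \<in> J" for i
    using c that by (simp add: d_def c_def the_inv_into_f_f del: o_apply)
  define K where "K = c ` J"
  define P where "P = N \<circ> d"
  define h where "h x = (\<lambda>i\<in>I. if i \<in> J then x (c i) else \<zero>\<^bsub>N i\<^esub>)" for x :: "'m \<Rightarrow> 'm"
  let ?D = "direct_sum I N" and ?E = "direct_sum K P"
  have supp: "{i \<in> I. h x i \<noteq> \<zero>\<^bsub>N i\<^esub>} = d ` {k \<in> K. x k \<noteq> \<zero>\<^bsub>P k\<^esub>}" for x
    using JI by (force simp: h_def K_def P_def dc image_iff)
  have hD: "h x \<in> carrier ?D" if "x \<in> carrier ?E" for x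
  proof -
    have "finite {i \<in> I. h x i \<noteq> \<zero>\<^bsub>N i\<^esub>}" unfolding supp using that by simp
    moreover have "h x \<in> (\<Pi>\<^sub>E i\<in>I. carrier (N i))"
      using that zN by (auto simp: h_def K_def P_def dc PiE_iff)
    ultimately show ?thesis by simp
  qed
  have "h \<in> mod_hom R ?E ?D"
  proof -
    have 1: "h (x \<oplus>\<^bsub>?E\<^esub> y) = h x \<oplus>\<^bsub>?D\<^esub> h y" for x y
    proof -
      have "\<zero>\<^bsub>N i\<^esub> \<oplus>\<^bsub>N i\<^esub> \<zero>\<^bsub>N i\<^esub> = \<zero>\<^bsub>N i\<^esub>" if "i \<in> I" for i
        using mN[OF that] zN[OF that]
        by (simp add: Module.module_def abelian_group_def abelian_monoid.r_zero)
      then show ?thesis by (auto simp: h_def K_def P_def dc intro!: restrict_ext)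
    qed
    have 2: "h (r \<odot>\<^bsub>?E\<^esub> x) = r \<odot>\<^bsub>?D\<^esub> h x" if "r \<in> carrier R" for r x
      using that by (auto simp: h_def K_def P_def dc Module.module.smult_r_null[OF mN] intro!: restrict_ext)
    show ?thesis
      unfolding mod_hom_def using hD 1 2 by (simp del: direct_sum_simps)
  qed
  moreover have "bij_betw h (carrier ?E) (carrier ?D)"
  proof (rule bij_betw_imageI)
    show "inj_on h (carrier ?E)"
    proof (rule inj_onI)
      fix x y assume x: "x \<in> carrier ?E" and y: "y \<in> carrier ?E" and eq: "h x = h y"
      have "x (c i) = y (c i)" if "i \<in> J" for i
        using fun_cong[OF eq, of i] that JI by (auto simp: h_def)
      then show "x = y"
        using x y by (intro extensionalityI[of _ K]) (auto simp: PiE_iff K_def)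
    qed
    show "h ` carrier ?E = carrier ?D"
    proof (intro equalityI subsetI)
      fix x assume x: "x \<in> carrier ?D"
      define y where "y = (\<lambda>k\<in>K. x (d k))"
      have hy: "h y = x"
        using x outside[of x] JI
        by (intro extensionalityI[of _ I]) (auto simp: h_def y_def K_def dc PiE_iff)
      have "{k \<in> K. y k \<noteq> \<zero>\<^bsub>P k\<^esub>} \<subseteq> c ` {i \<in> I. x i \<noteq> \<zero>\<^bsub>N i\<^esub>}"
        using JI by (auto simp: y_def K_def P_def dc)
      then have "finite {k \<in> K. y k \<noteq> \<zero>\<^bsub>P k\<^esub>}"
        by (rule finite_subset) (use x in simp)
      then have "y \<in> carrier ?E"
        using x JI by (auto simp: y_def K_def P_def dc PiE_iff)
      with hy show "x \<in> h ` carrier ?E" by blast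
    qed (use hD in blast)
  qed
  ultimately have "f \<circ> h \<in> mod_iso R ?E M"
  proof -
    assume hh: "h \<in> mod_hom R ?E ?D" and hb: "bij_betw h (carrier ?E) (carrier ?D)"
    have "bij_betw (f \<circ> h) (carrier ?E) (carrier M)"
      using bij_betw_trans[OF hb bf] .
    moreover have "f \<circ> h \<in> mod_hom R ?E M"
      using hh hf unfolding mod_hom_def by (simp add: Pi_iff del: direct_sum_simps)
    ultimately show ?thesis by (simp add: mod_iso_def)
  qed
  moreover have "\<forall>k\<in>K. P k \<in> \<S>"
    using N JI by (auto simp: K_def P_def dc)
  ultimately show ?thesis
    using S(2) M unfolding closed_under_direct_sums_def by blast
qed

end

theory Submission
  imports Defs "HOL-Algebra.Free_Abelian_Groups"
begin

text \<open>
  For the first part, let \<open>M\<close> be isomorphic to a direct sum of modules on which the \<open>C\<close> condition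
  holds. Every summand embeds into \<open>M\<close>, so it inherits from \<open>M\<close> both that it is \<open>\<aa>\<close>-torsion and, by
  closure under submodules, that its part annihilated by \<open>\<aa>\<close> belongs to \<open>\<S>\<close>
  (\<open>C_premise_inherited\<close>). Hence every summand belongs to \<open>\<S>\<close>, and so does \<open>M\<close>.

  For the second part, let \<open>M\<close> be an \<open>\<aa>\<close>-torsion module and \<open>F k\<close> its submodule of elements killed
  by \<open>\<aa>\<^sup>k\<close>, so that \<open>M\<close> is the increasing union of the \<open>F k\<close> and \<open>F 1\<close> belongs to \<open>\<S>\<close> by assumption.
  Finitely many generators of \<open>\<aa>\<close> map \<open>F (k + 1)\<close> into \<open>F k\<close> with common kernel \<open>F 1\<close>, so all \<open>F k\<close>
  belong to \<open>\<S>\<close> by closure under submodules and extensions (\<open>ann_filtration_in_Serre\<close>).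
  The union \<open>M\<close> is a quotient of the direct sum of the \<open>F k\<close>.

  The last step needs care, because the direct sum may be too large for the type 'm on which the
  modules of \<open>\<S>\<close> live. If \<open>M\<close> is finite, then \<open>M\<close> equals some \<open>F k\<close> and no direct sum is needed. If
  \<open>M\<close> is infinite, a direct sum of countably many subsets of \<open>M\<close> is no larger than \<open>M\<close>, by
  \<open>|M|\<^sup>2 = |M|\<close> and the fact that \<open>M\<close> has only \<open>|M|\<close> finite subsets, so it can be transported to 'm
  (\<open>direct_sum_lepoll\<close>, \<open>module_transport\<close>, \<open>torsion_union_infinite\<close>).
\<close>

section \<open>Homomorphisms and transport of structure\<close>

lemma mod_hom_zero:
  assumes N: "Module.module R N" and M: "Module.module R M" and f: "f \<in> mod_hom R N M"
  shows "f \<zero>\<^bsub>N\<^esub> = \<zero>\<^bsub>M\<^esub>"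
proof -
  interpret N: Module.module R N by (rule N)
  interpret M: Module.module R M by (rule M)
  have "f (\<zero>\<^bsub>R\<^esub> \<odot>\<^bsub>N\<^esub> \<zero>\<^bsub>N\<^esub>) = \<zero>\<^bsub>R\<^esub> \<odot>\<^bsub>M\<^esub> f \<zero>\<^bsub>N\<^esub>"
    using f unfolding mod_hom_def by blast
  moreover have "f \<zero>\<^bsub>N\<^esub> \<in> carrier M"
    using f by (auto simp: mod_hom_def)
  ultimately show ?thesis by simp
qed

lemma mod_hom_comp:
  assumes "f \<in> mod_hom R L M" "g \<in> mod_hom R M N"
  shows "g \<circ> f \<in> mod_hom R L N"
  using assms by (simp add: mod_hom_def Pi_iff)

lemma mod_hom_inclusion:
  assumes "H \<subseteq> K"
  shows "(\<lambda>x. x) \<in> mod_hom R (M\<lparr>carrier := H\<rparr>) (M\<lparr>carrier := K\<rparr>)"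
  using assms by (auto simp: mod_hom_def)

lemma mod_iso_inv_hom:
  assumes N: "Module.module R N" and g: "g \<in> mod_iso R N M"
  shows "inv_into (carrier N) g \<in> mod_hom R M N"
proof -
  interpret N: Module.module R N by (rule N)
  let ?h = "inv_into (carrier N) g"
  have bij: "bij_betw g (carrier N) (carrier M)" and gh: "g \<in> mod_hom R N M"
    using g by (simp_all add: mod_iso_def)
  have hN: "?h y \<in> carrier N" "g (?h y) = y" if "y \<in> carrier M" for y
    using bij that by (auto simp: bij_betw_def inv_into_into f_inv_into_f)
  have hg: "?h (g x) = x" if "x \<in> carrier N" for x
    using bij that by (simp add: bij_betw_def)
  have "?h (x \<oplus>\<^bsub>M\<^esub> y) = ?h x \<oplus>\<^bsub>N\<^esub> ?h y" if "x \<in> carrier M" "y \<in> carrier M" for x y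
  proof -
    have "g (?h x \<oplus>\<^bsub>N\<^esub> ?h y) = x \<oplus>\<^bsub>M\<^esub> y"
      using gh hN that by (simp add: mod_hom_def)
    then show ?thesis
      using hg[OF N.M.a_closed[OF hN(1)[OF that(1)] hN(1)[OF that(2)]]] by simp
  qed
  moreover have "?h (r \<odot>\<^bsub>M\<^esub> x) = r \<odot>\<^bsub>N\<^esub> ?h x" if "r \<in> carrier R" "x \<in> carrier M" for r x
  proof -
    have "g (r \<odot>\<^bsub>N\<^esub> ?h x) = r \<odot>\<^bsub>M\<^esub> x"
      using gh hN that by (simp add: mod_hom_def)
    then show ?thesis
      using hg[OF N.smult_closed[OF that(1) hN(1)[OF that(2)]]] by simp
  qed
  ultimately show ?thesis
    unfolding mod_hom_def using hN(1) by simp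
qed

text \<open>
  A direct sum is constructed on a type of functions, while a class of modules only has members on
  its own ground type. An injection of the carrier into that ground type suffices to move the
  module there.
\<close>

lemma module_transport:
  fixes N :: "('r, 'n) module" and g :: "'n \<Rightarrow> 'm"
  assumes N: "Module.module R N" and g: "inj_on g (carrier N)"
  obtains M :: "('r, 'm) module" where "Module.module R M" "g \<in> mod_iso R N M"
proof -
  interpret N: Module.module R N by (rule N)
  define h where "h = inv_into (carrier N) g"
  have hg [simp]: "h (g x) = x" if "x \<in> carrier N" for x
    using g that by (simp add: h_def)
  define M :: "('r, 'm) module" where "M =
    \<lparr>carrier = g ` carrier N, monoid.mult = undefined, one = undefined, ring.zero = g \<zero>\<^bsub>N\<^esub>,
     ring.add = (\<lambda>x y. g (h x \<oplus>\<^bsub>N\<^esub> h y)), smult = (\<lambda>r x. g (r \<odot>\<^bsub>N\<^esub> h x))\<rparr>"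
  have simps [simp]: "carrier M = g ` carrier N" "\<zero>\<^bsub>M\<^esub> = g \<zero>\<^bsub>N\<^esub>"
      "x \<oplus>\<^bsub>M\<^esub> y = g (h x \<oplus>\<^bsub>N\<^esub> h y)" "r \<odot>\<^bsub>M\<^esub> x = g (r \<odot>\<^bsub>N\<^esub> h x)" for x y r
    by (simp_all add: M_def)
  have "Module.module R M"
  proof (rule moduleI)
    show "abelian_group M"
    proof (rule abelian_groupI)
      fix x assume "x \<in> carrier M"
      then obtain u where u: "u \<in> carrier N" "x = g u" by auto
      show "\<exists>y\<in>carrier M. y \<oplus>\<^bsub>M\<^esub> x = \<zero>\<^bsub>M\<^esub>"
        by (rule bexI[of _ "g (\<ominus>\<^bsub>N\<^esub> u)"]) (use u in \<open>simp_all add: N.M.l_neg\<close>)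
    qed (auto simp: N.M.a_ac)
  qed (use N.is_cring in \<open>auto simp: N.smult_l_distr N.smult_r_distr N.smult_assoc1\<close>)
  moreover have "g \<in> mod_iso R N M"
    using g by (auto simp: mod_iso_def mod_hom_def bij_betw_def)
  ultimately show ?thesis by (rule that)
qed

section \<open>Direct sums\<close>

definition summand_incl :: "'i set \<Rightarrow> ('i \<Rightarrow> ('r, 'm) module) \<Rightarrow> 'i \<Rightarrow> 'm \<Rightarrow> 'i \<Rightarrow> 'm" where
  "summand_incl I N i m = (\<lambda>j\<in>I. if j = i then m else \<zero>\<^bsub>N j\<^esub>)"

lemma summand_incl_hom:
  assumes N: "\<And>j. j \<in> I \<Longrightarrow> Module.module R (N j)" and i: "i \<in> I"
  shows "summand_incl I N i \<in> mod_hom R (N i) (direct_sum I N)"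
proof -
  let ?e = "summand_incl I N i"
  have am: "abelian_monoid (N j)" if "j \<in> I" for j
    using N[OF that] by (simp add: Module.module_def abelian_group_def)
  have fin: "finite {j \<in> I. ?e m j \<noteq> \<zero>\<^bsub>N j\<^esub>}" for m
    by (rule finite_subset[of _ "{i}"]) (auto simp: summand_incl_def)
  show ?thesis
    using fin i
    by (auto simp: mod_hom_def summand_incl_def abelian_monoid.zero_closed[OF am]
        abelian_monoid.r_zero[OF am] Module.module.smult_r_null[OF N] intro!: restrict_ext)
qed

lemma summand_incl_inj: "i \<in> I \<Longrightarrow> inj (summand_incl I N i)"
  by (rule injI) (auto simp: summand_incl_def dest: fun_cong[where x = i])

text \<open>
  A finitely supported family is determined by its graph over the support, which is a finite subset
  of \<open>I \<times> A\<close>; and \<open>A\<close>, being infinite, is as large as \<open>A \<times> A\<close> and as its set of finite subsets.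
\<close>

lemma direct_sum_lepoll:
  assumes A: "infinite A" and I: "I \<lesssim> A" and N: "\<And>i. i \<in> I \<Longrightarrow> carrier (N i) \<subseteq> A"
  shows "carrier (direct_sum I N) \<lesssim> A"
proof -
  define \<gamma> where "\<gamma> x = {(i, x i) |i. i \<in> I \<and> x i \<noteq> \<zero>\<^bsub>N i\<^esub>}" for x
  have "inj_on \<gamma> (carrier (direct_sum I N))"
  proof (rule inj_onI)
    fix x y
    assume x: "x \<in> carrier (direct_sum I N)" and y: "y \<in> carrier (direct_sum I N)"
      and eq: "\<gamma> x = \<gamma> y"
    have "x i = y i" if i: "i \<in> I" for i
    proof -
      have "(i, v) \<in> \<gamma> x \<longleftrightarrow> v = x i \<and> v \<noteq> \<zero>\<^bsub>N i\<^esub>"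
           "(i, v) \<in> \<gamma> y \<longleftrightarrow> v = y i \<and> v \<noteq> \<zero>\<^bsub>N i\<^esub>" for v
        using i by (auto simp: \<gamma>_def)
      with eq show ?thesis by metis
    qed
    then show "x = y"
      using x y by (intro extensionalityI[of _ I]) (auto simp: PiE_iff)
  qed
  moreover have "\<gamma> x \<in> Fpow (I \<times> A)" if x: "x \<in> carrier (direct_sum I N)" for x
  proof -
    have "\<gamma> x = (\<lambda>i. (i, x i)) ` {i \<in> I. x i \<noteq> \<zero>\<^bsub>N i\<^esub>}"
      by (auto simp: \<gamma>_def)
    then have "finite (\<gamma> x)" using x by simp
    moreover have "\<gamma> x \<subseteq> I \<times> A" using x N by (auto simp: \<gamma>_def)
    ultimately show ?thesis by (simp add: Fpow_def)
  qed
  ultimately have 1: "carrier (direct_sum I N) \<lesssim> Fpow (I \<times> A)"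
    unfolding lepoll_def by blast
  have "I \<times> A \<lesssim> A \<times> A" using I by (rule times_lepoll_mono) simp
  also have "A \<times> A \<approx> A"
    using card_of_Times_same_infinite[OF A] by (simp add: eqpoll_iff_card_of_ordIso)
  finally have "I \<times> A \<lesssim> A" .
  then obtain p where p: "inj_on p (I \<times> A)" "p ` (I \<times> A) \<subseteq> A"
    unfolding lepoll_def by blast
  have "inj_on (image p) (Fpow (I \<times> A))"
    using inj_on_image_Pow[OF p(1)] by (rule inj_on_subset) (auto simp: Fpow_def)
  moreover have "image p ` Fpow (I \<times> A) \<subseteq> Fpow A"
    using p(2) by (fastforce simp: Fpow_def)
  ultimately have "Fpow (I \<times> A) \<lesssim> Fpow A"
    unfolding lepoll_def by blast
  also have "Fpow A \<approx> A" by (rule eqpoll_Fpow[OF A])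
  finally show ?thesis using 1 lepoll_trans by blast
qed

definition sum_map :: "'i set \<Rightarrow> ('r, 'm) module \<Rightarrow> ('i \<Rightarrow> 'm) \<Rightarrow> 'm" where
  "sum_map I M x = finsum M x {i \<in> I. x i \<noteq> \<zero>\<^bsub>M\<^esub>}"

lemma sum_map_hom:
  assumes M: "Module.module R M" and H: "\<And>i. i \<in> I \<Longrightarrow> submodule (H i) R M"
  shows "sum_map I M \<in> mod_hom R (direct_sum I (\<lambda>i. M\<lparr>carrier := H i\<rparr>)) M"
proof -
  interpret M: Module.module R M by (rule M)
  let ?D = "direct_sum I (\<lambda>i. M\<lparr>carrier := H i\<rparr>)"
  have HM: "H i \<subseteq> carrier M" if "i \<in> I" for i
    using M.submoduleE(1)[OF H[OF that]] .
  have D: "x i \<in> carrier M" if "x \<in> carrier ?D" "i \<in> I" for x i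
    using that HM by (auto simp: PiE_iff)
  have fD: "finite {i \<in> I. x i \<noteq> \<zero>\<^bsub>M\<^esub>}" if "x \<in> carrier ?D" for x
    using that by simp
  (* The sum may be taken over any finite set containing the support; this lets two families
     with different supports be added over a common index set. *)
  have ext: "sum_map I M x = finsum M x A"
    if "finite A" "A \<subseteq> I" "{i \<in> I. x i \<noteq> \<zero>\<^bsub>M\<^esub>} \<subseteq> A" "\<And>i. i \<in> I \<Longrightarrow> x i \<in> carrier M" for x A
    unfolding sum_map_def
    by (rule M.M.add.finprod_mono_neutral_cong_left) (use that in auto)
  have closed: "sum_map I M x \<in> carrier M" if "x \<in> carrier ?D" for x
    unfolding sum_map_def by (rule M.M.finsum_closed) (use D[OF that] in auto)
  have add: "sum_map I M (x \<oplus>\<^bsub>?D\<^esub> y) = sum_map I M x \<oplus>\<^bsub>M\<^esub> sum_map I M y"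
    if x: "x \<in> carrier ?D" and y: "y \<in> carrier ?D" for x y
  proof -
    let ?A = "{i \<in> I. x i \<noteq> \<zero>\<^bsub>M\<^esub>} \<union> {i \<in> I. y i \<noteq> \<zero>\<^bsub>M\<^esub>}"
    note xM = D[OF x] and yM = D[OF y]
    have fA: "finite ?A" using fD[OF x] fD[OF y] by simp
    have "sum_map I M (x \<oplus>\<^bsub>?D\<^esub> y) = finsum M (x \<oplus>\<^bsub>?D\<^esub> y) ?A"
      by (rule ext[OF fA]) (use xM yM in auto)
    also have "\<dots> = finsum M (\<lambda>i. x i \<oplus>\<^bsub>M\<^esub> y i) ?A"
      by (rule M.M.finsum_cong') (use xM yM in auto)
    also have "\<dots> = finsum M x ?A \<oplus>\<^bsub>M\<^esub> finsum M y ?A"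
      by (rule M.M.finsum_addf) (use xM yM in auto)
    also have "finsum M x ?A = sum_map I M x"
      by (rule ext[OF fA, symmetric]) (use xM in auto)
    also have "finsum M y ?A = sum_map I M y"
      by (rule ext[OF fA, symmetric]) (use yM in auto)
    finally show ?thesis .
  qed
  have smult: "sum_map I M (r \<odot>\<^bsub>?D\<^esub> x) = r \<odot>\<^bsub>M\<^esub> sum_map I M x"
    if r: "r \<in> carrier R" and x: "x \<in> carrier ?D" for r x
  proof -
    let ?A = "{i \<in> I. x i \<noteq> \<zero>\<^bsub>M\<^esub>}"
    note xM = D[OF x]
    have "sum_map I M (r \<odot>\<^bsub>?D\<^esub> x) = finsum M (r \<odot>\<^bsub>?D\<^esub> x) ?A"
      by (rule ext[OF fD[OF x]]) (use r xM in auto)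
    also have "\<dots> = finsum M (\<lambda>i. r \<odot>\<^bsub>M\<^esub> x i) ?A"
      by (rule M.M.finsum_cong') (use r xM in auto)
    also have "\<dots> = r \<odot>\<^bsub>M\<^esub> sum_map I M x"
      unfolding sum_map_def
      by (rule M.finsum_smult_ldistr[symmetric]) (use fD[OF x] r xM in auto)
    finally show ?thesis .
  qed
  show ?thesis
    unfolding mod_hom_def using closed add smult by (simp del: direct_sum_simps)
qed

lemma sum_map_summand_incl:
  assumes M: "Module.module R M" and i: "i \<in> I" and m: "m \<in> carrier M"
  shows "sum_map I M (summand_incl I (\<lambda>i. M\<lparr>carrier := H i\<rparr>) i m) = m"
proof -
  interpret M: Module.module R M by (rule M)
  let ?x = "summand_incl I (\<lambda>i. M\<lparr>carrier := H i\<rparr>) i m"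
  have xi: "?x i = m" using i by (simp add: summand_incl_def)
  show ?thesis
  proof (cases "m = \<zero>\<^bsub>M\<^esub>")
    case True
    then have "{j \<in> I. ?x j \<noteq> \<zero>\<^bsub>M\<^esub>} = {}" by (auto simp: summand_incl_def)
    then show ?thesis unfolding sum_map_def using True by (simp only: M.M.finsum_empty)
  next
    case False
    then have "{j \<in> I. ?x j \<noteq> \<zero>\<^bsub>M\<^esub>} = {i}" using i by (auto simp: summand_incl_def)
    then show ?thesis unfolding sum_map_def using m xi by (simp only:) simp
  qed
qed

section \<open>Submodules in a torsion subcategory\<close>

lemma closed_under_submodulesD:
  assumes "closed_under_submodules R \<S>" "M\<lparr>carrier := K\<rparr> \<in> \<S>" "Module.module R M"
    and "submodule H R M" "H \<subseteq> K"
  shows "M\<lparr>carrier := H\<rparr> \<in> \<S>"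
proof -
  have "M\<lparr>carrier := H\<rparr> \<in> RMod R"
    using submodule.submodule_is_module[OF assms(4,3)] by (simp add: RMod_def)
  moreover have "inj_on (\<lambda>x. x) (carrier (M\<lparr>carrier := H\<rparr>))" by simp
  ultimately show ?thesis
    using assms(1,2) mod_hom_inclusion[OF assms(5), of R M]
    unfolding closed_under_submodules_def by blast
qed

text \<open>
  A sum of submodules is a quotient of their direct sum, but the direct sum must exist in the
  universe of the class before closure under direct sums says anything about it. When \<open>M\<close> is
  infinite and has at least as many elements as there are submodules, the direct sum is no larger
  than \<open>M\<close>, so a copy of it lives on the ground type; for finite \<open>M\<close> it may be larger.
\<close>

lemma torsion_union_infinite:
  fixes M :: "('r, 'm) module" and I :: "'i set"
  assumes S: "torsion_subcategory R \<S>" and R: "cring R" and M: "Module.module R M"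
    and inf: "infinite (carrier M)" and I: "I \<lesssim> carrier M"
    and H: "\<And>i. i \<in> I \<Longrightarrow> submodule (H i) R M" "\<And>i. i \<in> I \<Longrightarrow> M\<lparr>carrier := H i\<rparr> \<in> \<S>"
    and un: "carrier M = (\<Union>i\<in>I. H i)"
  shows "M \<in> \<S>"
proof -
  let ?N = "\<lambda>i. M\<lparr>carrier := H i\<rparr>"
  let ?D = "direct_sum I ?N"
  have SR: "\<S> \<subseteq> RMod R" and Sq: "closed_under_quotients R \<S>" and Sd: "closed_under_direct_sums R \<S>"
    using S by (auto simp: torsion_subcategory_def Serre_def)
  have mN: "Module.module R (?N i)" if "i \<in> I" for i
    using submodule.submodule_is_module[OF H(1)[OF that] M] .
  have D: "Module.module R ?D" by (rule module_direct_sum[OF R mN])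
  have "carrier ?D \<lesssim> carrier M"
    by (rule direct_sum_lepoll[OF inf I]) (use un in auto)
  then obtain g :: "('i \<Rightarrow> 'm) \<Rightarrow> 'm" where g: "inj_on g (carrier ?D)"
    unfolding lepoll_def by blast
  obtain D' :: "('r, 'm) module" where D': "Module.module R D'" "g \<in> mod_iso R ?D D'"
    by (rule module_transport[OF D g])
  have "D' \<in> \<S>"
    by (rule closed_under_direct_sums_any_index[OF SR Sd _ _ D'(2)])
       (use H(2) D'(1) in \<open>simp_all add: RMod_def\<close>)
  moreover
  have bij: "bij_betw g (carrier ?D) (carrier D')"
    using D'(2) by (simp_all add: mod_iso_def del: direct_sum_simps)
  let ?h = "inv_into (carrier ?D) g"
  have hg: "?h (g x) = x" if "x \<in> carrier ?D" for x
    using g that by (rule inv_into_f_f)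
  have "?h \<in> mod_hom R D' ?D" using D D'(2) by (rule mod_iso_inv_hom)
  then have q: "sum_map I M \<circ> ?h \<in> mod_hom R D' M"
    using sum_map_hom[OF M H(1)] by (rule mod_hom_comp)
  moreover have "(sum_map I M \<circ> ?h) ` carrier D' = carrier M"
  proof (intro equalityI subsetI)
    fix m assume m: "m \<in> carrier M"
    then obtain i where i: "i \<in> I" "m \<in> H i" using un by auto
    let ?x = "summand_incl I ?N i m"
    have x: "?x \<in> carrier ?D"
      using summand_incl_hom[where N = ?N and R = R, OF mN i(1)] i(2)
      by (auto simp: mod_hom_def simp del: direct_sum_simps)
    have gx: "g ?x \<in> carrier D'" using bij x by (rule bij_betwE[THEN bspec])
    have eq: "(sum_map I M \<circ> ?h) (g ?x) = m"
      using hg[OF x] sum_map_summand_incl[OF M i(1) m] by simp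
    show "m \<in> (sum_map I M \<circ> ?h) ` carrier D'"
      using imageI[OF gx, of "sum_map I M \<circ> ?h"] by (simp only: eq)
  qed (use q in \<open>auto simp: mod_hom_def simp del: o_apply\<close>)
  ultimately show "M \<in> \<S>"
    using Sq M unfolding closed_under_quotients_def RMod_def by blast
qed

text \<open>
  Multiplication by a scalar \<open>b\<close> is an endomorphism because the ring is commutative, so \<open>Q\<close> is an
  extension of a submodule of \<open>P\<close>, the image \<open>b Q\<close>, by the kernel of \<open>b\<close> on \<open>Q\<close>. Restricting to
  the kernel and continuing with the next scalar peels off finitely many scalars until only their
  common kernel is left. Going through kernels one at a time avoids the embedding of the quotient
  of \<open>Q\<close> by that common kernel into a power of \<open>P\<close>, which might be too large for the universe.
\<close>

lemma Serre_of_multiplications: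
  fixes M :: "('r, 'm) module"
  assumes S: "Serre R \<S>" and M: "Module.module R M"
    and P: "submodule P R M" "M\<lparr>carrier := P\<rparr> \<in> \<S>"
    and B: "finite B" "B \<subseteq> carrier R"
    and Q: "submodule Q R M" "\<And>b x. b \<in> B \<Longrightarrow> x \<in> Q \<Longrightarrow> b \<odot>\<^bsub>M\<^esub> x \<in> P"
    and K: "M\<lparr>carrier := {x \<in> Q. \<forall>b\<in>B. b \<odot>\<^bsub>M\<^esub> x = \<zero>\<^bsub>M\<^esub>}\<rparr> \<in> \<S>"
  shows "M\<lparr>carrier := Q\<rparr> \<in> \<S>"
  using B Q K
proof (induction B arbitrary: Q rule: finite_induct)
  case empty
  then show ?case by simp
next
  case (insert b B)
  interpret M: Module.module R M by (rule M)
  have b: "b \<in> carrier R" using insert.prems by simp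
  note QE = M.submoduleE[OF insert.prems(2)]
  have QM: "x \<in> carrier M" if "x \<in> Q" for x using QE(1) that by blast
  have z: "\<zero>\<^bsub>M\<^esub> \<in> Q" using subgroup.one_closed[OF submodule.axioms(1)[OF insert.prems(2)]] by simp
  let ?Q = "{x \<in> Q. b \<odot>\<^bsub>M\<^esub> x = \<zero>\<^bsub>M\<^esub>}" and ?T = "(\<lambda>x. b \<odot>\<^bsub>M\<^esub> x) ` Q"
  have comm: "b \<odot>\<^bsub>M\<^esub> (r \<odot>\<^bsub>M\<^esub> x) = r \<odot>\<^bsub>M\<^esub> (b \<odot>\<^bsub>M\<^esub> x)" if "r \<in> carrier R" "x \<in> Q" for r x
    using b that QM by (metis M.smult_assoc1 M.R.m_comm)
  have Q': "submodule ?Q R M"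
    by (rule M.submoduleI)
       (use b z QE QM in \<open>auto simp: M.smult_r_minus M.smult_r_distr comm\<close>)
  have T: "submodule ?T R M"
  proof (rule M.submoduleI)
    show "\<zero>\<^bsub>M\<^esub> \<in> ?T" using z b by (metis M.smult_r_null imageI)
    show "\<ominus>\<^bsub>M\<^esub> x \<in> ?T" if "x \<in> ?T" for x
      using that b QE(3) QM by (auto simp flip: M.smult_r_minus)
    show "x \<oplus>\<^bsub>M\<^esub> y \<in> ?T" if "x \<in> ?T" "y \<in> ?T" for x y
      using that b QE(5) QM by (auto simp flip: M.smult_r_distr)
    show "r \<odot>\<^bsub>M\<^esub> x \<in> ?T" if "r \<in> carrier R" "x \<in> ?T" for r x
      using that QE(4) by (auto simp flip: comm)
  qed (use b QM in auto)
  have Ssub: "closed_under_submodules R \<S>" and Sext: "closed_under_extensions R \<S>"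
    using S by (auto simp: Serre_def)
  have "M\<lparr>carrier := ?Q\<rparr> \<in> \<S>"
  proof (rule insert.IH)
    have "{x \<in> ?Q. \<forall>c\<in>B. c \<odot>\<^bsub>M\<^esub> x = \<zero>\<^bsub>M\<^esub>} = {x \<in> Q. \<forall>c\<in>insert b B. c \<odot>\<^bsub>M\<^esub> x = \<zero>\<^bsub>M\<^esub>}"
      by blast
    then show "M\<lparr>carrier := {x \<in> ?Q. \<forall>c\<in>B. c \<odot>\<^bsub>M\<^esub> x = \<zero>\<^bsub>M\<^esub>}\<rparr> \<in> \<S>"
      using insert.prems(4) by simp
  qed (use insert.prems Q' in auto)
  moreover have "M\<lparr>carrier := ?T\<rparr> \<in> \<S>"
    by (rule closed_under_submodulesD[OF Ssub P(2) M T]) (use insert.prems(3) in auto)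
  moreover have "M\<lparr>carrier := Q\<rparr> \<in> RMod R"
    using submodule.submodule_is_module[OF insert.prems(2) M] by (simp add: RMod_def)
  moreover have "short_exact R (M\<lparr>carrier := ?Q\<rparr>) (\<lambda>x. x) (M\<lparr>carrier := Q\<rparr>)
      (\<lambda>x. b \<odot>\<^bsub>M\<^esub> x) (M\<lparr>carrier := ?T\<rparr>)"
    using b QM by (auto simp: short_exact_def mod_hom_def M.smult_r_distr comm)
  ultimately show ?case
    using Sext unfolding closed_under_extensions_def by blast
qed

section \<open>The annihilator filtration of a module\<close>

text \<open>
  The \<open>k\<close>-th step is the submodule of elements killed by \<open>\<aa>\<^sup>k\<close>. The recursive form exposes that
  multiplication by an element of \<open>\<aa>\<close> lowers the step by one, which is what inductions use.
\<close>

primrec ann_filtration :: "'r set \<Rightarrow> ('r, 'm) module \<Rightarrow> nat \<Rightarrow> 'm set" where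
  "ann_filtration \<aa> M 0 = {\<zero>\<^bsub>M\<^esub>}"
| "ann_filtration \<aa> M (Suc k) = {x \<in> carrier M. \<forall>r\<in>\<aa>. r \<odot>\<^bsub>M\<^esub> x \<in> ann_filtration \<aa> M k}"

lemma ideal_pow:
  assumes "cring R" and "ideal \<aa> R"
  shows "ideal (\<aa> [^]\<^bsub>ideals_set R\<^esub> (k::nat)) R"
proof -
  interpret cring R by fact
  have "monoid (ideals_set R)"
    using ideals_set_is_comm_monoid by (rule comm_monoid.axioms)
  then have "\<aa> [^]\<^bsub>ideals_set R\<^esub> k \<in> carrier (ideals_set R)"
    using assms(2) by (intro monoid.nat_pow_closed) (simp_all add: ideals_set_def)
  then show ?thesis by (simp add: ideals_set_def)
qed

lemma ann_filtration_submodule: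
  assumes M: "Module.module R M" and a: "ideal \<aa> R"
  shows "submodule (ann_filtration \<aa> M k) R M"
proof (induction k)
  interpret M: Module.module R M by (rule M)
  {
    case 0
    show ?case by (rule M.submoduleI) auto
  next
    case (Suc k)
    have z: "\<zero>\<^bsub>M\<^esub> \<in> ann_filtration \<aa> M k"
      using subgroup.one_closed[OF submodule.axioms(1)[OF Suc]] by simp
    note E = M.submoduleE[OF Suc]
    show ?case
    proof (rule M.submoduleI)
      fix s x assume s: "s \<in> carrier R" and x: "x \<in> ann_filtration \<aa> M (Suc k)"
      have "r \<odot>\<^bsub>M\<^esub> (s \<odot>\<^bsub>M\<^esub> x) \<in> ann_filtration \<aa> M k" if r: "r \<in> \<aa>" for r
        using x s ideal.I_r_closed[OF a r s] ideal.Icarr[OF a r] by (simp flip: M.smult_assoc1)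
      then show "s \<odot>\<^bsub>M\<^esub> x \<in> ann_filtration \<aa> M (Suc k)" using s x by simp
    qed (use z E in \<open>auto simp: ideal.Icarr[OF a] M.smult_r_minus M.smult_r_distr\<close>)
  }
qed

lemma ann_filtration_mono:
  assumes M: "Module.module R M" and a: "ideal \<aa> R" and "j \<le> k"
  shows "ann_filtration \<aa> M j \<subseteq> ann_filtration \<aa> M k"
proof -
  interpret M: Module.module R M by (rule M)
  have "ann_filtration \<aa> M k \<subseteq> ann_filtration \<aa> M (Suc k)" for k
    by (induction k) (auto simp: ideal.Icarr[OF a])
  then show ?thesis using \<open>j \<le> k\<close> by (rule lift_Suc_mono_le)
qed

lemma ann_filtration_Suc_0:
  "M\<lparr>carrier := ann_filtration \<aa> M (Suc 0)\<rparr> = annihilated \<aa> M"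
  by (simp add: annihilated_def)

lemma killed_by_power_in_ann_filtration:
  assumes M: "Module.module R M" and a: "ideal \<aa> R" and x: "x \<in> carrier M"
    and "\<forall>r \<in> \<aa> [^]\<^bsub>ideals_set R\<^esub> k. r \<odot>\<^bsub>M\<^esub> x = \<zero>\<^bsub>M\<^esub>"
  shows "x \<in> ann_filtration \<aa> M k"
  using x assms(4)
proof (induction k arbitrary: x)
  interpret M: Module.module R M by (rule M)
  {
    case 0
    then have "\<one>\<^bsub>R\<^esub> \<odot>\<^bsub>M\<^esub> x = \<zero>\<^bsub>M\<^esub>" by (simp add: ideals_set_def)
    with 0 show ?case by simp
  next
    case (Suc k)
    have "b \<odot>\<^bsub>M\<^esub> x \<in> ann_filtration \<aa> M k" if b: "b \<in> \<aa>" for b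
    proof (rule Suc.IH)
      have pow: "ideal (\<aa> [^]\<^bsub>ideals_set R\<^esub> k) R"
        by (rule ideal_pow[OF M.R.is_cring a])
      show "\<forall>r \<in> \<aa> [^]\<^bsub>ideals_set R\<^esub> k. r \<odot>\<^bsub>M\<^esub> (b \<odot>\<^bsub>M\<^esub> x) = \<zero>\<^bsub>M\<^esub>"
      proof
        fix r assume r: "r \<in> \<aa> [^]\<^bsub>ideals_set R\<^esub> k"
        then have "r \<otimes>\<^bsub>R\<^esub> b \<in> \<aa> [^]\<^bsub>ideals_set R\<^esub> Suc k"
          using b by (simp add: ideals_set_def ideal_prod.prod)
        then have "(r \<otimes>\<^bsub>R\<^esub> b) \<odot>\<^bsub>M\<^esub> x = \<zero>\<^bsub>M\<^esub>" using Suc.prems by blast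
        then show "r \<odot>\<^bsub>M\<^esub> (b \<odot>\<^bsub>M\<^esub> x) = \<zero>\<^bsub>M\<^esub>"
          using ideal.Icarr[OF pow r] ideal.Icarr[OF a b] Suc.prems(1) by (simp add: M.smult_assoc1)
      qed
    qed (use Suc.prems ideal.Icarr[OF a b] in auto)
    with Suc.prems show ?case by simp
  }
qed

text \<open>
  This is where the noetherian hypothesis enters: finitely many generators of \<open>\<aa>\<close> map the step
  \<open>Suc k\<close> into the step \<open>k\<close>, and the elements that they all kill form the first step, which is the
  annihilated submodule. Hence every step is a finitely iterated extension of modules in the class.
\<close>

lemma ann_filtration_in_Serre:
  fixes M :: "('r, 'm) module"
  assumes S: "Serre R \<S>" and R: "noetherian_ring R" and M: "Module.module R M"
    and a: "ideal \<aa> R" and ann: "annihilated \<aa> M \<in> \<S>"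
  shows "M\<lparr>carrier := ann_filtration \<aa> M k\<rparr> \<in> \<S>"
proof (induction k)
  interpret M: Module.module R M by (rule M)
  let ?F = "ann_filtration \<aa> M"
  have Ssub: "closed_under_submodules R \<S>" using S by (simp add: Serre_def)
  have F1: "M\<lparr>carrier := ?F (Suc 0)\<rparr> \<in> \<S>"
    using ann by (simp only: ann_filtration_Suc_0)
  {
    case 0
    show ?case
      by (rule closed_under_submodulesD[OF Ssub F1 M ann_filtration_submodule[OF M a]
            ann_filtration_mono[OF M a]]) simp
  next
    case (Suc k)
    obtain B where B: "B \<subseteq> carrier R" "finite B" "\<aa> = Idl\<^bsub>R\<^esub> B"
      using noetherian_ring.finetely_gen[OF R a] by blast
    have Ba: "B \<subseteq> \<aa>" using M.R.genideal_self[OF B(1)] B(3) by simp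
    let ?K = "{x \<in> ?F (Suc k). \<forall>b\<in>B. b \<odot>\<^bsub>M\<^esub> x = \<zero>\<^bsub>M\<^esub>}"
    have FM: "?F (Suc k) \<subseteq> carrier M" by auto
    (* The annihilator of an element is an ideal, so killing the generators is killing the ideal. *)
    have ann_ideal: "ideal {r \<in> carrier R. r \<odot>\<^bsub>M\<^esub> x = \<zero>\<^bsub>M\<^esub>} R" if x: "x \<in> carrier M" for x
    proof (rule idealI[OF M.R.ring_axioms])
      show "subgroup {r \<in> carrier R. r \<odot>\<^bsub>M\<^esub> x = \<zero>\<^bsub>M\<^esub>} (add_monoid R)"
        by (rule M.R.add.subgroupI)
           (use x in \<open>auto simp: M.smult_l_distr M.smult_l_minus simp flip: a_inv_def\<close>)
    next
      fix r s assume r: "r \<in> {r \<in> carrier R. r \<odot>\<^bsub>M\<^esub> x = \<zero>\<^bsub>M\<^esub>}" and s: "s \<in> carrier R"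
      show "s \<otimes>\<^bsub>R\<^esub> r \<in> {r \<in> carrier R. r \<odot>\<^bsub>M\<^esub> x = \<zero>\<^bsub>M\<^esub>}"
        using r s x by (simp add: M.smult_assoc1)
      then show "r \<otimes>\<^bsub>R\<^esub> s \<in> {r \<in> carrier R. r \<odot>\<^bsub>M\<^esub> x = \<zero>\<^bsub>M\<^esub>}"
        using r s by (simp add: M.R.m_comm)
    qed
    have "\<aa> \<subseteq> {r \<in> carrier R. r \<odot>\<^bsub>M\<^esub> x = \<zero>\<^bsub>M\<^esub>}" if "x \<in> ?K" for x
      unfolding B(3)
      by (rule M.R.genideal_minimal[OF ann_ideal]) (use that B(1) in auto)
    then have "?K = ?F (Suc 0)"
      using Ba ann_filtration_mono[OF M a, of "Suc 0" "Suc k"] by auto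
    with F1 have "M\<lparr>carrier := ?K\<rparr> \<in> \<S>" by simp
    then show ?case
      by (rule Serre_of_multiplications[OF S M ann_filtration_submodule[OF M a] Suc B(2,1)
            ann_filtration_submodule[OF M a], rotated]) (use Ba in auto)
  }
qed

section \<open>The \<open>C\<close> condition on direct sums and for torsion subcategories\<close>

text \<open>
  The premise of the \<open>C\<close> condition passes to submodules: an injective homomorphism reflects the
  equation saying that a scalar kills an element.
\<close>

lemma C_premise_inherited:
  assumes S: "closed_under_submodules R \<S>" and a: "ideal \<aa> R"
    and N: "Module.module R N" and M: "Module.module R M"
    and f: "f \<in> mod_hom R N M" "inj_on f (carrier N)"
    and prem: "Gamma R \<aa> M = carrier M" "annihilated \<aa> M \<in> \<S>"
  shows "Gamma R \<aa> N = carrier N" "annihilated \<aa> N \<in> \<S>"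
proof -
  interpret N: Module.module R N by (rule N)
  have fM: "f x \<in> carrier M" if "x \<in> carrier N" for x
    using f(1) that by (auto simp: mod_hom_def)
  have smult: "f (r \<odot>\<^bsub>N\<^esub> x) = r \<odot>\<^bsub>M\<^esub> f x" if "r \<in> carrier R" "x \<in> carrier N" for r x
    using f(1) that by (auto simp: mod_hom_def)
  note zero = mod_hom_zero[OF N M f(1)]
  have reflect: "r \<odot>\<^bsub>M\<^esub> f x = \<zero>\<^bsub>M\<^esub> \<longleftrightarrow> r \<odot>\<^bsub>N\<^esub> x = \<zero>\<^bsub>N\<^esub>"
    if "r \<in> carrier R" "x \<in> carrier N" for r x
    using that f(2) by (metis N.M.zero_closed N.smult_closed inj_onD smult zero)
  have powR: "r \<in> carrier R" if "r \<in> \<aa> [^]\<^bsub>ideals_set R\<^esub> (k::nat)" for r k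
    using ideal.Icarr[OF ideal_pow[OF N.R.is_cring a] that] .
  show "Gamma R \<aa> N = carrier N"
  proof (intro equalityI subsetI)
    fix x assume x: "x \<in> carrier N"
    then have "f x \<in> Gamma R \<aa> M" using fM prem(1) by simp
    then obtain k :: nat where "k \<ge> 1" "\<forall>r \<in> \<aa> [^]\<^bsub>ideals_set R\<^esub> k. r \<odot>\<^bsub>M\<^esub> f x = \<zero>\<^bsub>M\<^esub>"
      by (auto simp: Gamma_def)
    then show "x \<in> Gamma R \<aa> N" using x reflect powR unfolding Gamma_def by blast
  qed (auto simp: Gamma_def)
  have "f \<in> mod_hom R (annihilated \<aa> N) (annihilated \<aa> M)"
    using f(1) reflect ideal.Icarr[OF a] by (auto simp: mod_hom_def annihilated_def)
  moreover have "inj_on f (carrier (annihilated \<aa> N))"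
    using f(2) by (rule inj_on_subset) (auto simp: annihilated_def)
  moreover have "annihilated \<aa> N \<in> RMod R"
    using module_annihilated[OF N a] by (simp add: RMod_def)
  ultimately show "annihilated \<aa> N \<in> \<S>"
    using S prem(2) unfolding closed_under_submodules_def by blast
qed

lemma C_class_direct_sums:
  fixes \<S> :: "('r, 'm) module set"
  assumes Ssub: "closed_under_submodules R \<S>" and a: "ideal \<aa> R" and Sd: "closed_under_direct_sums R \<S>"
  shows "closed_under_direct_sums R (C_class R \<aa> \<S>)"
  unfolding closed_under_direct_sums_def
proof (intro allI ballI impI, elim conjE exE)
  fix I :: "'m set" and N and M :: "('r, 'm) module" and f
  assume MR: "M \<in> RMod R" and N: "\<forall>i\<in>I. N i \<in> C_class R \<aa> \<S>"
    and f: "f \<in> mod_iso R (direct_sum I N) M"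
  have M: "Module.module R M" using MR by (simp add: RMod_def)
  have mN: "Module.module R (N i)" if "i \<in> I" for i
    using N that by (auto simp: C_class_def RMod_def)
  have fh: "f \<in> mod_hom R (direct_sum I N) M" and fi: "inj_on f (carrier (direct_sum I N))"
    using f by (auto simp: mod_iso_def bij_betw_def)
  have "M \<in> \<S>" if prem: "Gamma R \<aa> M = carrier M" "annihilated \<aa> M \<in> \<S>"
  proof -
    have "N i \<in> \<S>" if i: "i \<in> I" for i
    proof -
      let ?e = "summand_incl I N i"
      have e: "?e \<in> mod_hom R (N i) (direct_sum I N)" using mN i by (rule summand_incl_hom)
      then have h: "f \<circ> ?e \<in> mod_hom R (N i) M" using fh by (rule mod_hom_comp)
      have "?e ` carrier (N i) \<subseteq> carrier (direct_sum I N)"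
        using e by (auto simp: mod_hom_def simp del: direct_sum_simps)
      then have "inj_on f (?e ` carrier (N i))" by (rule inj_on_subset[OF fi])
      moreover have "inj_on ?e (carrier (N i))"
        by (rule inj_on_subset[OF summand_incl_inj[OF i] subset_UNIV])
      ultimately have "inj_on (f \<circ> ?e) (carrier (N i))" by (intro comp_inj_on)
      note C_premise_inherited[OF Ssub a mN[OF i] M h this prem]
      then show ?thesis using N i by (auto simp: C_class_def C_condition_at_def)
    qed
    then show ?thesis using Sd MR f unfolding closed_under_direct_sums_def by blast
  qed
  then show "M \<in> C_class R \<aa> \<S>" using MR by (simp add: C_class_def C_condition_at_def)
qed

text \<open>
  If \<open>M\<close> is \<open>\<aa>\<close>-torsion, its annihilator filtration exhausts it. A finite module is reached after
  finitely many steps, and an infinite one is a countable union of members of the class.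
\<close>

lemma torsion_C_condition:
  fixes \<S> :: "('r, 'm) module set"
  assumes R: "cring R" "noetherian_ring R" and a: "ideal \<aa> R" and S: "torsion_subcategory R \<S>"
  shows "C_condition R \<aa> \<S>"
proof -
  have "M \<in> \<S>"
    if MR: "M \<in> RMod R" and G: "Gamma R \<aa> M = carrier M" and ann: "annihilated \<aa> M \<in> \<S>"
    for M :: "('r, 'm) module"
  proof -
    have M: "Module.module R M" using MR by (simp add: RMod_def)
    let ?F = "ann_filtration \<aa> M"
    have sub: "submodule (?F k) R M" for k by (rule ann_filtration_submodule[OF M a])
    have F: "M\<lparr>carrier := ?F k\<rparr> \<in> \<S>" for k
      by (rule ann_filtration_in_Serre[OF _ R(2) M a ann]) (use S in \<open>simp add: torsion_subcategory_def\<close>)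
    have "\<exists>k. x \<in> ?F k" if "x \<in> carrier M" for x
    proof -
      have "x \<in> Gamma R \<aa> M" using G that by simp
      then show ?thesis
        using killed_by_power_in_ann_filtration[OF M a that] unfolding Gamma_def by blast
    qed
    then have un: "carrier M = (\<Union>k. ?F k)"
      using Module.module.submoduleE(1)[OF M sub] by blast
    show "M \<in> \<S>"
    proof (cases "finite (carrier M)")
      case True
      have chain: "subset.chain UNIV (range ?F)"
        unfolding subset_chain_def using ann_filtration_mono[OF M a]
        by (simp add: image_iff) (metis nat_le_linear)
      obtain B where "B \<in> range ?F" "carrier M \<subseteq> B"
        by (rule finite_subset_Union_chain[OF True _ _ chain]) (use un in auto)
      then obtain k where "carrier M = ?F k" using un by blast
      then have "M\<lparr>carrier := carrier M\<rparr> \<in> \<S>" using F[of k] by (simp only:)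
      then show ?thesis by simp
    next
      case False
      then have "(UNIV :: nat set) \<lesssim> carrier M" by (simp add: infinite_le_lepoll)
      then show ?thesis
        by (rule torsion_union_infinite[where H = ?F, OF S R(1) M False _ sub F un])
    qed
  qed
  then show ?thesis by (auto simp: C_condition_def C_class_def C_condition_at_def)
qed

theorem theorem2p17:
  fixes R :: "('r, 'x) ring_scheme"
    and \<S> :: "('r, 'm) module set"
    and \<aa> :: "'r set"
  assumes "cring R" and "noetherian_ring R"
    and "\<S> \<subseteq> RMod R" and "closed_under_submodules R \<S>"
    and "ideal \<aa> R"
  shows "(closed_under_direct_sums R \<S> \<longrightarrow> closed_under_direct_sums R (C_class R \<aa> \<S>)) \<and>
         (torsion_subcategory R \<S> \<longrightarrow> C_condition R \<aa> \<S>)"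
  by (intro conjI impI C_class_direct_sums[OF assms(4,5)] torsion_C_condition[OF assms(1,2,5)])

end
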